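(* Let $(X,\|\cdot\|)$ be a normed linear space, let $A\subseteq X$ be a retract of $X$, let $a,b\in\mathbb{R}$ with $a<b$, and set $$\mathcal{C}:=[a,b]\times A,\qquad \mathcal{C}_{l}:=\{a\}\times A,\qquad \mathcal{C}_{r}:=\{b\}\times A.$$ Let $D\subseteq\mathbb{R}\times X$ and let $\phi=(\phi_1,\phi_2)\colon D\to\mathbb{R}\times X$ be a map. Suppose that there exists a closed set $W\subseteq D\cap\mathcal{C}$ such that (i) $\phi$ is compact on $W$; (ii) for every path $\sigma\subseteq\mathcal{C}$ with $\sigma\cap\mathcal{C}_{l}\neq\emptyset$ and $\sigma\cap\mathcal{C}_{r}\neq\emptyset$ there exists a sub-path $\gamma\subseteq\sigma\cap W$ with $\phi(\gamma)\subseteq\mathcal{C}$, $\phi(\gamma)\cap\mathcal{C}_{l}\neq\emptyset$ and $\phi(\gamma)\cap\mathcal{C}_{r}\neq\emptyset$. Then there exists $\tilde z\in W$ such that $\phi(\tilde z)=\tilde z$.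
   Context: A nonempty subset $A$ of a topological space $Y$ is a retract of $Y$ if there is a continuous map $r\colon Y\to A$ with $r|_A=Id_A$. A map between metric spaces is compact if it is continuous and the closure of its image is a compact subset of the target space; "$\phi$ is compact on $W$" means that the restriction $\phi|_W$ is compact. No continuity of $\phi$ outside $W$ is assumed. A path is a continuous map $\sigma$ from a compact interval $I\subseteq\mathbb{R}$ (usually $I=[0,1]$) into $\mathbb{R}\times X$; its support is $\sigma(I)$. A sub-path of $\sigma$ is a restriction $\gamma=\sigma|_{[s_0,s_1]}$ with $[s_0,s_1]\subseteq I$. In set-theoretic expressions a path denotes its support: for a set $Z$, $\sigma\subseteq Z$ means $\sigma(I)\subseteq Z$, $\sigma\cap Z\neq\emptyset$ means $\sigma(I)\cap Z\neq\emptyset$, and $\phi(\gamma)$ is the image under $\phi$ of the support of $\gamma$. "A sub-path $\gamma\subseteq\sigma\cap W$" means a sub-path $\gamma$ of $\sigma$ whose support is contained in $W$. *)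

theory Defs
  imports "HOL-Analysis.Analysis"
begin

text \<open>
  The closure is taken in the whole target space, and nothing is required of \<open>f\<close> outside \<open>W\<close>.
\<close>
definition compact_map_on :: "'a::metric_space set \<Rightarrow> ('a \<Rightarrow> 'b::metric_space) \<Rightarrow> bool" where
  "compact_map_on W f \<longleftrightarrow> continuous_on W f \<and> compact (closure (f ` W))"

end

theory Submission
  imports Defs
begin

text \<open>
  Write a point of the strip as \<open>(t, x)\<close> and let \<open>r\<close> be the retraction onto \<open>A\<close>. Suppose that, for
  a given \<open>\<delta> > 0\<close>, some path \<open>\<sigma>\<close> in \<open>C\<close> goes from the left face to the right face so that, at each
  of its points in \<open>W\<close>, the equation \<open>x = \<phi>\<^sub>2 (t, x)\<close> holds up to an error controlled by \<open>\<delta>\<close>. The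
  stretching hypothesis yields a piece of \<open>\<sigma>\<close> inside \<open>W\<close> whose image joins the two faces; along this
  piece \<open>\<phi>\<^sub>1 - t\<close> changes sign, so it vanishes at some point, which is then an approximate fixed point
  of \<open>\<phi>\<close> in \<open>W\<close>. Letting \<open>\<delta>\<close> tend to \<open>0\<close>, compactness of \<open>\<phi>\<close> on the closed set \<open>W\<close> gives a
  fixed point.

  The work is in finding \<open>\<sigma>\<close> (\<open>approximate_crossing_path\<close>). A Schauder projection replaces
  \<open>\<phi>\<^sub>2\<close> by a combination of finitely many vectors whose coefficients extend from \<open>W\<close> to the whole
  space by Tietze's theorem. This leaves a family \<open>H\<^sub>t\<close> of self-maps of a finite-dimensional cube,
  \<open>0 \<le> t \<le> 1\<close>, and the claim that points nearly fixed by \<open>H\<^sub>t\<close> can be followed along a path from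
  \<open>t = 0\<close> to \<open>t = 1\<close> (\<open>browder_path\<close>). This is a path version of a theorem of Browder: if no such
  path existed, the fixed points could be separated into those reachable from \<open>t = 0\<close> and the others,
  and pushing the first kind towards \<open>t = 1\<close> and the second towards \<open>t = 0\<close> would give a self-map of a
  cube of one more dimension without fixed point, contradicting Brouwer's theorem.

  The dimension of the cube is only known inside the proof, so Brouwer's theorem is needed for cubes
  whose dimension is a number and not a type; it is derived here from Kuhn's combinatorial lemma.
\<close>

section \<open>Brouwer's theorem for cubes of variable dimension\<close>

text \<open>
  The coordinates from \<open>n\<close> on are pinned to \<open>0\<close>: the cubes of all dimensions then live in one metric
  space, in which they are compact.
\<close>
definition nat_cube :: "nat \<Rightarrow> (nat \<Rightarrow> real) set" where
  "nat_cube n = {x. (\<forall>i. 0 \<le> x i \<and> x i \<le> 1) \<and> (\<forall>i\<ge>n. x i = 0)}"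

lemma compact_nat_cube: "compact (nat_cube n)"
proof -
  have "nat_cube n = (\<Pi>\<^sub>E i\<in>UNIV. if i < n then {0..1} else {0})"
    by (auto simp: nat_cube_def PiE_iff not_le split: if_splits)
       (metis atLeastAtMost_iff not_le order_refl singletonD zero_le_one)+
  moreover have "compactin (product_topology (\<lambda>i. euclideanreal) UNIV)
                   (\<Pi>\<^sub>E i\<in>UNIV. if i < n then {0..1} else {0})"
    by (simp add: compactin_PiE)
  ultimately show ?thesis
    by (simp add: euclidean_product_topology)
qed

lemma tendsto_fun_iff:
  fixes f :: "'b \<Rightarrow> 'i \<Rightarrow> 'c::topological_space"
  shows "(f \<longlongrightarrow> l) F \<longleftrightarrow> (\<forall>i. ((\<lambda>x. f x i) \<longlongrightarrow> l i) F)"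
  using limitin_componentwise[of "\<lambda>_::'i. euclidean :: 'c topology" UNIV f l F]
  by (simp add: euclidean_product_topology)

text \<open>
  Label a vertex of the grid of mesh \<open>1 / p\<close> in direction \<open>i\<close> according to whether \<open>f\<close> moves its
  \<open>i\<close>-th coordinate up or down. Kuhn's lemma finds a grid cell having, for each \<open>i\<close>, vertices of both
  kinds. As the mesh shrinks, the cells accumulate at a point that \<open>f\<close> moves neither up nor down in
  any direction.
\<close>
theorem brouwer_nat_cube:
  assumes contf: "continuous_on (nat_cube n) f" and fim: "f \<in> nat_cube n \<rightarrow> nat_cube n"
  shows "\<exists>x\<in>nat_cube n. f x = x"
proof -
  define grid where "grid p k = (\<lambda>i. if i < n then real (k i) / real p else 0)"
    for p :: nat and k :: "nat \<Rightarrow> nat"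
  have grid_cube: "grid p k \<in> nat_cube n" if "\<forall>i<n. k i \<le> p" "0 < p" for p k
    using that by (auto simp: grid_def nat_cube_def)
  (* On the upper face the label has to be 1 even at points fixed in direction i: hence "k i < p". *)
  define label where
    "label p k i = (if k i < p \<and> grid p k i \<le> f (grid p k) i then 0 else 1::nat)" for p k i
  have label0: "label p k i = 0 \<Longrightarrow> grid p k i \<le> f (grid p k) i" for p k i
    by (auto simp: label_def split: if_splits)
  have label1: "f (grid p k) i \<le> grid p k i"
    if "label p k i \<noteq> 0" "\<forall>i<n. k i \<le> p" "0 < p" "i < n" for p k i
  proof (cases "k i < p")
    case True
    then show ?thesis using that by (auto simp: label_def split: if_splits)
  next
    case False
    then have "grid p k i = 1"
      using that by (auto simp: grid_def dest: le_antisym)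
    then show ?thesis
      using fim grid_cube[of k p] that by (auto simp: nat_cube_def)
  qed
  (* x is a corner of Kuhn's cell; in direction i, f does not move u down and does not move v up. *)
  have near_vertices: "\<exists>x\<in>nat_cube n. \<forall>i<n. \<exists>u\<in>nat_cube n. \<exists>v\<in>nat_cube n.
          (\<forall>j. \<bar>u j - x j\<bar> \<le> 1 / real p) \<and> (\<forall>j. \<bar>v j - x j\<bar> \<le> 1 / real p)
          \<and> u i \<le> f u i \<and> f v i \<le> v i" if "0 < p" for p
  proof -
    obtain q where q: "\<forall>i<n. q i < p"
      and rs: "\<forall>i<n. \<exists>r s. (\<forall>j<n. q j \<le> r j \<and> r j \<le> q j + 1) \<and>
                           (\<forall>j<n. q j \<le> s j \<and> s j \<le> q j + 1) \<and> label p r i \<noteq> label p s i"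
    proof (rule kuhn_lemma[of p n "label p"])
      show "\<forall>x. (\<forall>i<n. x i \<le> p) \<longrightarrow> (\<forall>i<n. x i = 0 \<longrightarrow> label p x i = 0)"
      proof (intro allI impI)
        fix k i assume k: "\<forall>i<n. k i \<le> p" "i < n" "k i = (0::nat)"
        then have "0 \<le> f (grid p k) i"
          using fim grid_cube[of k p] \<open>0 < p\<close> by (auto simp: nat_cube_def)
        then show "label p k i = 0"
          using k \<open>0 < p\<close> by (simp add: label_def grid_def)
      qed
    qed (use \<open>0 < p\<close> in \<open>auto simp: label_def\<close>)
    have close: "\<bar>grid p r j - grid p q j\<bar> \<le> 1 / real p"
      if "\<forall>j<n. q j \<le> r j \<and> r j \<le> q j + 1" for r j
    proof (cases "j < n")
      case True
      then have "q j \<le> r j" "r j \<le> q j + 1" using that by auto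
      then have "\<bar>real (r j) - real (q j)\<bar> \<le> 1" by linarith
      then have "\<bar>real (r j) - real (q j)\<bar> / real p \<le> 1 / real p"
        by (simp add: divide_right_mono)
      then show ?thesis using True by (simp add: grid_def flip: diff_divide_distrib)
    qed (simp add: grid_def)
    have le: "\<forall>j<n. r j \<le> p" if "\<forall>j<n. q j \<le> r j \<and> r j \<le> q j + 1" for r
    proof (intro allI impI)
      fix j assume "j < n"
      then have "r j \<le> q j + 1" "q j < p" using that q by auto
      then show "r j \<le> p" by linarith
    qed
    show ?thesis
    proof (rule bexI[of _ "grid p q"], intro allI impI)
      show "grid p q \<in> nat_cube n" using q \<open>0 < p\<close> by (intro grid_cube) (auto intro: less_imp_le)
      fix i assume "i < n"
      then obtain r s where r: "\<forall>j<n. q j \<le> r j \<and> r j \<le> q j + 1"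
        and s: "\<forall>j<n. q j \<le> s j \<and> s j \<le> q j + 1" and "label p r i \<noteq> label p s i"
        using rs by blast
      then consider "label p r i = 0" "label p s i \<noteq> 0" | "label p s i = 0" "label p r i \<noteq> 0"
        by (auto simp: label_def split: if_splits)
      then show "\<exists>u\<in>nat_cube n. \<exists>v\<in>nat_cube n.
          (\<forall>j. \<bar>u j - grid p q j\<bar> \<le> 1 / real p) \<and> (\<forall>j. \<bar>v j - grid p q j\<bar> \<le> 1 / real p)
          \<and> u i \<le> f u i \<and> f v i \<le> v i"
      proof cases
        case 1
        then show ?thesis
          using close[OF r] close[OF s] le[OF r] le[OF s] label0[of p r i] label1[of p s i]
            grid_cube[of _ p] \<open>0 < p\<close> \<open>i < n\<close> by blast
      next
        case 2
        then show ?thesis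
          using close[OF r] close[OF s] le[OF r] le[OF s] label0[of p s i] label1[of p r i]
            grid_cube[of _ p] \<open>0 < p\<close> \<open>i < n\<close> by blast
      qed
    qed
  qed
  have "\<forall>p. \<exists>x\<in>nat_cube n. \<forall>i<n. \<exists>u\<in>nat_cube n. \<exists>v\<in>nat_cube n.
          (\<forall>j. \<bar>u j - x j\<bar> \<le> 1 / real (Suc p)) \<and> (\<forall>j. \<bar>v j - x j\<bar> \<le> 1 / real (Suc p))
          \<and> u i \<le> f u i \<and> f v i \<le> v i"
    using near_vertices by blast
  then obtain x where x: "\<And>p. x p \<in> nat_cube n"
    and xuv: "\<And>p i. i < n \<Longrightarrow> \<exists>u\<in>nat_cube n. \<exists>v\<in>nat_cube n.
          (\<forall>j. \<bar>u j - x p j\<bar> \<le> 1 / real (Suc p)) \<and> (\<forall>j. \<bar>v j - x p j\<bar> \<le> 1 / real (Suc p))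
          \<and> u i \<le> f u i \<and> f v i \<le> v i"
    by metis
  obtain l \<theta> where l: "l \<in> nat_cube n" "strict_mono (\<theta> :: nat \<Rightarrow> nat)" "(x \<circ> \<theta>) \<longlonglongrightarrow> l"
    using compact_nat_cube[of n, unfolded compact_eq_seq_compact_metric seq_compact_def] x
    by metis
  have w_lim: "(\<lambda>p. w p i) \<longlonglongrightarrow> l i" "(\<lambda>p. f (w p) i) \<longlonglongrightarrow> f l i"
    if w: "\<And>p. w p \<in> nat_cube n" "\<And>p j. \<bar>w p j - x (\<theta> p) j\<bar> \<le> 1 / real (Suc (\<theta> p))" for w i
  proof -
    have lim: "w \<longlonglongrightarrow> l"
      unfolding tendsto_fun_iff
    proof
      fix j
      have "(\<lambda>p. 1 / real (Suc (\<theta> p))) \<longlonglongrightarrow> 0"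
        using LIMSEQ_subseq_LIMSEQ[OF LIMSEQ_Suc[OF lim_1_over_n] l(2)] by (simp add: o_def)
      then have "(\<lambda>p. w p j - x (\<theta> p) j) \<longlonglongrightarrow> 0"
        by (rule Lim_null_comparison[rotated]) (use w(2) in auto)
      moreover have "(\<lambda>p. x (\<theta> p) j) \<longlonglongrightarrow> l j"
        using l(3) by (simp add: tendsto_fun_iff)
      ultimately show "(\<lambda>p. w p j) \<longlonglongrightarrow> l j"
        using tendsto_add by fastforce
    qed
    have "(\<lambda>p. f (w p)) \<longlonglongrightarrow> f l"
      by (rule continuous_on_tendsto_compose[OF contf lim l(1)]) (use w in auto)
    then show "(\<lambda>p. w p i) \<longlonglongrightarrow> l i" "(\<lambda>p. f (w p) i) \<longlonglongrightarrow> f l i"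
      using lim by (simp_all add: tendsto_fun_iff)
  qed
  have "f l i = l i" for i
  proof (cases "i < n")
    case True
    (* The two vertices depend on the direction i, so they are chosen as sequences only now. *)
    have "\<forall>p. \<exists>uv. fst uv \<in> nat_cube n \<and> snd uv \<in> nat_cube n
        \<and> (\<forall>j. \<bar>fst uv j - x (\<theta> p) j\<bar> \<le> 1 / real (Suc (\<theta> p)))
        \<and> (\<forall>j. \<bar>snd uv j - x (\<theta> p) j\<bar> \<le> 1 / real (Suc (\<theta> p)))
        \<and> fst uv i \<le> f (fst uv) i \<and> f (snd uv) i \<le> snd uv i"
      using xuv[OF True] by (simp add: Bex_def) blast
    from choice[OF this] obtain uv where uv: "\<And>p. fst (uv p) \<in> nat_cube n" "\<And>p. snd (uv p) \<in> nat_cube n"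
      "\<And>p j. \<bar>fst (uv p) j - x (\<theta> p) j\<bar> \<le> 1 / real (Suc (\<theta> p))"
      "\<And>p j. \<bar>snd (uv p) j - x (\<theta> p) j\<bar> \<le> 1 / real (Suc (\<theta> p))"
      "\<And>p. fst (uv p) i \<le> f (fst (uv p)) i" "\<And>p. f (snd (uv p)) i \<le> snd (uv p) i"
      by blast
    have "l i \<le> f l i"
      using LIMSEQ_le[OF w_lim[of "\<lambda>p. fst (uv p)" i, OF uv(1,3)]] uv(5) by blast
    moreover have "f l i \<le> l i"
      using LIMSEQ_le[OF w_lim(2,1)[of "\<lambda>p. snd (uv p)" i, OF uv(2,4)]] uv(6) by blast
    ultimately show ?thesis by simp
  next
    case False
    then show ?thesis
      using fim l(1) by (auto simp: nat_cube_def not_less)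
  qed
  then show ?thesis using l(1) by blast
qed

section \<open>Following approximate fixed points of a family of maps\<close>

lemma locally_path_connected_space_real_times_fun:
  "locally_path_connected_space (euclidean :: (real \<times> ('i \<Rightarrow> real)) topology)"
proof -
  have "path_connected_space euclideanreal"
    using convex_imp_path_connected[OF convex_UNIV] path_connectedin_topspace[of euclideanreal]
    by simp
  then have "locally_path_connected_space (euclidean :: ('i \<Rightarrow> real) topology)"
    by (subst euclidean_product_topology[symmetric])
       (auto simp: locally_path_connected_space_product_topology locally_path_connected_space_euclideanreal)
  then have "locally_path_connected_space
      (prod_topology euclideanreal (euclidean :: ('i \<Rightarrow> real) topology))"
    by (simp add: locally_path_connected_space_prod_topology locally_path_connected_space_euclideanreal
        del: prod_topology_euclidean)
  then show ?thesis by simp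
qed

lemma open_path_component_set:
  assumes "locally_path_connected_space (euclidean :: 'b::topological_space topology)" "open (U :: 'b set)"
  shows "open (path_component_set U z)"
proof -
  have "locally_path_connected_space (top_of_set U)"
    by (rule locally_path_connected_space_open_subset[OF assms(1)]) (use assms(2) in simp)
  then have "openin (top_of_set U) (Collect (path_component_of (top_of_set U) z))"
    by (rule openin_path_component_of_locally_path_connected_space)
  moreover have "path_component_of (top_of_set U) z = path_component U z"
    by (rule ext) simp
  ultimately have "openin (top_of_set U) (path_component_set U z)"
    by simp
  then show ?thesis
    using assms(2) by (rule openin_open_trans)
qed

lemma normal_space_euclidean_metric: "normal_space (euclidean :: 'b::metric_space topology)"
  by (simp add: metrizable_imp_normal_space metrizable_space_euclidean)

text \<open>
  Let \<open>V\<close> be the part of \<open>U\<close> reachable from \<open>t = 0\<close>. As the surrounding space is locally path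
  connected, \<open>V\<close> and the rest of \<open>U\<close> are both open, so they cut the compact set \<open>F\<close> of fixed points
  into two closed pieces, and Urysohn's lemma gives a function \<open>\<tau>\<close> equal to \<open>1\<close> on the reachable piece
  and to \<open>0\<close> on the other. A fixed point of \<open>(t, c) \<mapsto> (\<tau> (t, c), H (t, c))\<close> lies in \<open>F\<close>; if it is
  reachable it has \<open>t = 1\<close> and a path as required leads to it, and if it is not it has \<open>t = 0\<close>, where
  all points of \<open>U\<close> are reachable.

  The path is only asked to stay in \<open>U\<close>, not in \<open>{0..1} \<times> nat_cube n\<close>: with \<open>U\<close> open in the whole
  space, local path connectedness is that of a product of copies of the real line.
\<close>
proposition browder_path:
  assumes contH: "continuous_on UNIV H" and Him: "\<And>z. H z \<in> nat_cube n"
    and "open U"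
    and FU: "\<And>t c. \<lbrakk>t \<in> {0..1}; c \<in> nat_cube n; H (t, c) = c\<rbrakk> \<Longrightarrow> (t, c) \<in> U"
  obtains p where "path p" "path_image p \<subseteq> U" "fst (pathstart p) = (0::real)" "fst (pathfinish p) = 1"
proof (rule ccontr)
  assume no_path: "\<not> thesis"
  define V where "V = (\<Union>z0 \<in> {z\<in>U. fst z = 0}. path_component_set U z0)"
  define V' where "V' = (\<Union>z \<in> U - V. path_component_set U z)"
  define F where "F = ({0..1} \<times> nat_cube n) \<inter> {z. H z = snd z}"
  have "open V" "open V'"
    unfolding V_def V'_def
    using open_path_component_set[OF locally_path_connected_space_real_times_fun \<open>open U\<close>] by auto
  have "V \<inter> V' = {}"
    unfolding V_def V'_def by (auto dest: path_component_sym path_component_trans)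
  have "U - V \<subseteq> V'"
    unfolding V'_def using path_component_refl by fastforce
  have "F \<subseteq> U" using FU by (force simp: F_def)
  have "closed {z. H z = snd z}"
    by (rule closed_Collect_eq[OF contH]) (intro continuous_intros)
  then have "closed F"
    unfolding F_def using compact_imp_closed[OF compact_nat_cube] by (intro closed_Int closed_Times) auto
  have "closed (F - V')" "closed (F - V)"
    using \<open>closed F\<close> \<open>open V\<close> \<open>open V'\<close> by auto
  moreover have "disjnt (F - V) (F - V')"
    using \<open>F \<subseteq> U\<close> \<open>U - V \<subseteq> V'\<close> by (auto simp: disjnt_def)
  ultimately obtain \<tau> where \<tau>: "continuous_map euclidean (top_of_set {0..1::real}) \<tau>"
      "\<tau> ` (F - V) \<subseteq> {0}" "\<tau> ` (F - V') \<subseteq> {1}"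
    using Urysohn_lemma[OF normal_space_euclidean_metric, of "F - V" "F - V'" 0 1] by auto
  then have cont\<tau>: "continuous_on UNIV \<tau>" and \<tau>01: "\<And>z. \<tau> z \<in> {0..1}"
    by (auto simp: continuous_map_in_subtopology)
  (* The first coordinate of the cube of dimension n + 1 plays the role of t. *)
  define split where "split x = (x 0, \<lambda>i. x (Suc i))" for x :: "nat \<Rightarrow> real"
  have cont_split: "continuous_on UNIV split"
    unfolding split_def
    by (intro continuous_on_Pair continuous_on_coordinatewise_then_product
        continuous_on_product_coordinates)
  define T where "T x = (\<lambda>i. case i of 0 \<Rightarrow> \<tau> (split x) | Suc j \<Rightarrow> H (split x) j)" for x
  have "continuous_on UNIV T"
  proof (rule continuous_on_coordinatewise_then_product)
    fix i
    have "continuous_on UNIV (\<lambda>x. \<tau> (split x))"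
      by (rule continuous_on_compose2[OF cont\<tau> cont_split]) simp
    moreover have "continuous_on UNIV (\<lambda>x. H (split x) j)" for j
      by (rule continuous_on_product_then_coordinatewise[OF continuous_on_compose2[OF contH cont_split]]) simp
    ultimately show "continuous_on UNIV (\<lambda>x. T x i)"
      by (cases i) (simp_all add: T_def)
  qed
  moreover have "T x \<in> nat_cube (Suc n)" for x
    using \<tau>01[of "split x"] Him[of "split x"]
    by (auto simp: nat_cube_def T_def split: nat.split)
  ultimately obtain x where x: "x \<in> nat_cube (Suc n)" "T x = x"
    using brouwer_nat_cube[of "Suc n" T] continuous_on_subset by blast
  have Tx: "\<tau> (split x) = fst (split x)" "H (split x) = snd (split x)"
    using fun_cong[OF x(2), of 0] fun_cong[OF x(2), of "Suc _"] by (auto simp: T_def split_def fun_eq_iff)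
  then have "split x \<in> F"
    using x(1) by (auto simp: F_def split_def nat_cube_def)
  show False
  proof (cases "split x \<in> V")
    case True
    then have "split x \<in> F - V'"
      using \<open>split x \<in> F\<close> \<open>V \<inter> V' = {}\<close> by blast
    then have "\<tau> (split x) = 1" using \<tau>(3) by blast
    then have "fst (split x) = 1" using Tx(1) by simp
    moreover obtain z0 where "fst z0 = 0" "path_component U z0 (split x)"
      using True by (auto simp: V_def)
    ultimately show False
      using no_path that unfolding path_component_def by metis
  next
    case False
    then have "\<tau> (split x) = 0" using \<open>split x \<in> F\<close> \<tau>(2) by blast
    then have "fst (split x) = 0" using Tx(1) by simp
    moreover have "split x \<in> U"
      using \<open>split x \<in> F\<close> \<open>F \<subseteq> U\<close> by blast
    moreover have "path_component U (split x) (split x)"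
      using \<open>split x \<in> U\<close> by (rule path_component_refl)
    ultimately have "split x \<in> V"
      unfolding V_def by blast
    then show False using False by simp
  qed
qed

section \<open>Approximate solutions crossing a strip\<close>

text \<open>
  The Schauder projection: the \<open>y i\<close> are the centres of a finite cover of \<open>K\<close> by \<open>\<delta>\<close>-balls, and the
  weight of \<open>y i\<close> at \<open>x\<close> vanishes unless \<open>x\<close> is in the ball around \<open>y i\<close>, so the weighted mean is
  within \<open>\<delta>\<close> of \<open>x\<close>. The coefficients, and not just the mean, are exported since they are real-valued
  and can be extended to larger sets.
\<close>
lemma schauder_coefficients:
  fixes K :: "'a::real_normed_vector set"
  assumes "compact K" "0 < \<delta>"
  obtains n and y :: "nat \<Rightarrow> 'a" and coeff :: "nat \<Rightarrow> 'a \<Rightarrow> real"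
  where "\<And>i. continuous_on K (coeff i)" "\<And>i x. x \<in> K \<Longrightarrow> coeff i x \<in> {0..1}"
    "\<And>x. x \<in> K \<Longrightarrow> dist x (\<Sum>i<n. coeff i x *\<^sub>R y i) < \<delta>"
proof -
  obtain k where k: "finite k" "k \<subseteq> K" "K \<subseteq> (\<Union>x\<in>k. ball x \<delta>)"
    using compactE_image[OF \<open>compact K\<close>, of K "\<lambda>x. ball x \<delta>"] \<open>0 < \<delta>\<close>
    by (metis UN_I centre_in_ball open_ball subsetI)
  obtain y and n :: nat where y: "k = y ` {..<n}"
    using finite_imp_nat_seg_image_inj_on[OF k(1)] by (metis lessThan_def)
  define \<mu> where "\<mu> i x = max 0 (\<delta> - dist x (y i))" for i x
  define s where "s x = (\<Sum>i<n. \<mu> i x)" for x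
  have \<mu>0: "0 \<le> \<mu> i x" for i x by (simp add: \<mu>_def)
  have s_pos: "0 < s x" if x: "x \<in> K" for x
  proof -
    obtain i where "i < n" "dist x (y i) < \<delta>"
      using k(3) x unfolding y by (auto simp: dist_commute)
    then show ?thesis
      unfolding s_def using \<mu>0 by (intro sum_pos2[of _ i]) (auto simp: \<mu>_def)
  qed
  show ?thesis
  proof
    fix i
    show "continuous_on K (\<lambda>x. if i < n then \<mu> i x / s x else 0)"
    proof (cases "i < n")
      case True
      have "continuous_on K (\<lambda>x. \<mu> j x)" for j
        unfolding \<mu>_def by (intro continuous_intros)
      then have "continuous_on K (\<lambda>x. \<mu> i x / s x)"
        unfolding s_def
        by (intro continuous_on_divide continuous_on_sum) (use s_pos in \<open>force simp: s_def\<close>)+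
      then show ?thesis using True by simp
    qed simp
    fix x assume x: "x \<in> K"
    have "\<mu> i x \<le> s x" if "i < n"
      unfolding s_def using that \<mu>0 by (intro member_le_sum[of i "{..<n}" "\<lambda>i. \<mu> i x"]) auto
    then show "(if i < n then \<mu> i x / s x else 0) \<in> {0..1}"
      using s_pos[OF x] \<mu>0 by auto
  next
    fix x assume x: "x \<in> K"
    define coeff where "coeff i = \<mu> i x / s x" for i
    have sum1: "(\<Sum>i<n. coeff i) = 1"
      using s_pos[OF x] by (simp add: coeff_def s_def flip: sum_divide_distrib)
    have coeff0: "0 \<le> coeff i" for i
      using s_pos[OF x] \<mu>0 by (simp add: coeff_def)
    have "x - (\<Sum>i<n. coeff i *\<^sub>R y i) = (\<Sum>i<n. coeff i *\<^sub>R (x - y i))"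
      by (simp add: scaleR_diff_right sum_subtractf sum1 flip: scaleR_sum_left)
    also have "norm \<dots> \<le> (\<Sum>i<n. coeff i * dist x (y i))"
      using coeff0 by (intro order_trans[OF norm_sum]) (simp add: dist_norm)
    also have "\<dots> < (\<Sum>i<n. coeff i * \<delta>)"
    proof (rule sum_strict_mono_ex1)
      show "\<forall>i\<in>{..<n}. coeff i * dist x (y i) \<le> coeff i * \<delta>"
        by (auto simp: coeff_def \<mu>_def max_def mult_left_mono divide_right_mono less_imp_le[OF s_pos[OF x]])
      obtain i where i: "i < n" "dist x (y i) < \<delta>"
        using k(3) x unfolding y by (auto simp: dist_commute)
      then have "0 < coeff i" using s_pos[OF x] by (simp add: coeff_def \<mu>_def)
      then show "\<exists>i\<in>{..<n}. coeff i * dist x (y i) < coeff i * \<delta>"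
        using i by (intro bexI[of _ i] mult_strict_left_mono) auto
    qed simp
    also have "\<dots> = \<delta>" by (simp add: sum1 flip: sum_distrib_right)
    finally show "dist x (\<Sum>i<n. (if i < n then \<mu> i x / s x else 0) *\<^sub>R y i) < \<delta>"
      by (simp add: dist_norm coeff_def)
  qed
qed

lemma tietze_closed_interval:
  fixes f :: "'b::metric_space \<Rightarrow> real"
  assumes "closed S" "continuous_on S f" "f ` S \<subseteq> {c..d}" "c \<le> d"
  obtains g where "continuous_on UNIV g" "\<And>x. x \<in> S \<Longrightarrow> g x = f x" "\<And>x. g x \<in> {c..d}"
proof -
  have "continuous_map (top_of_set S) euclideanreal f" using assms(2) by simp
  then obtain g where "continuous_map euclidean euclideanreal g" "\<And>x. x \<in> S \<Longrightarrow> g x = f x"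
      "g ` topspace euclidean \<subseteq> {c..d}"
    using Tietze_extension_closed_real_interval[OF normal_space_euclidean_metric _ _ assms(3,4)]
      assms(1) closed_closedin by metis
  then show ?thesis
    by (intro that[of g]) (simp_all add: image_subset_iff)
qed

text \<open>
  Follow the coefficient vector \<open>c\<close> of \<open>u\<close> instead of \<open>u\<close> itself. Wherever \<open>(t, r u)\<close> is in \<open>W\<close>, the
  extended coefficients at this point are the Schauder coefficients of \<open>g (t, r u)\<close>; hence if \<open>c\<close> is
  nearly equal to them, \<open>u\<close> is close to \<open>g (t, r u)\<close>. So \<open>browder_path\<close> applies to the map sending
  \<open>(t, c)\<close> to the extended coefficients.

  The error is measured between \<open>u\<close> and \<open>g (t, r u)\<close>, before \<open>r\<close> is applied: no modulus of continuity
  of \<open>r\<close> enters here, and in the limit continuity of \<open>r\<close> at one point suffices.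
\<close>
proposition approximate_crossing_path:
  fixes r :: "'a::real_normed_vector \<Rightarrow> 'b::metric_space" and g :: "real \<times> 'b \<Rightarrow> 'a"
  assumes contr: "continuous_on UNIV r"
    and "closed W" and contg: "continuous_on W g"
    and "compact K" and gK: "g ` W \<subseteq> K"
    and "0 < \<delta>" and "a < b"
  obtains t :: "real \<Rightarrow> real" and u :: "real \<Rightarrow> 'a"
  where "continuous_on {0..1} t" "continuous_on {0..1} u" "\<And>s. t s \<in> {a..b}" "t 0 = a" "t 1 = b"
    "\<And>s. \<lbrakk>s \<in> {0..1}; (t s, r (u s)) \<in> W\<rbrakk> \<Longrightarrow> dist (u s) (g (t s, r (u s))) < \<delta>"
proof -
  obtain n and y :: "nat \<Rightarrow> 'a" and coeff where coeff: "\<And>i. continuous_on K (coeff i)"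
      "\<And>i x. x \<in> K \<Longrightarrow> coeff i x \<in> {0..1::real}"
      "\<And>x. x \<in> K \<Longrightarrow> dist x (\<Sum>i<n. coeff i x *\<^sub>R y i) < \<delta> / 2"
    using schauder_coefficients[OF \<open>compact K\<close> half_gt_zero[OF \<open>0 < \<delta>\<close>]] by metis
  have "\<exists>h. continuous_on UNIV h \<and> (\<forall>z\<in>W. h z = coeff i (g z)) \<and> (\<forall>z. h z \<in> {0..1})" for i
  proof -
    have "continuous_on W (\<lambda>z. coeff i (g z))"
      using continuous_on_compose2[OF coeff(1) contg gK] .
    moreover have "(\<lambda>z. coeff i (g z)) ` W \<subseteq> {0..1}"
      using coeff(2) gK by blast
    ultimately show ?thesis
      by (rule tietze_closed_interval[OF \<open>closed W\<close>]) auto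
  qed
  then obtain h where conth: "\<And>i. continuous_on UNIV (h i)" 
    and hW: "\<And>i z. z \<in> W \<Longrightarrow> h i z = coeff i (g z)" and h01: "\<And>i z. h i z \<in> {0..1}"
    by metis
  define vec where "vec c = (\<Sum>i<n. c i *\<^sub>R y i)" for c :: "nat \<Rightarrow> real"
  (* The path of browder_path may leave 0 \<le> t \<le> 1; clamping keeps the time in {a..b}. *)
  define time where "time \<theta> = a + (b - a) * max 0 (min 1 \<theta>)" for \<theta> :: real
  define H where "H z = (\<lambda>i. if i < n then h i (time (fst z), r (vec (snd z))) else 0)"
    for z :: "real \<times> (nat \<Rightarrow> real)"
  have cont_time: "continuous_on UNIV time"
    unfolding time_def by (intro continuous_intros)
  have cont_vec: "continuous_on UNIV vec"
    unfolding vec_def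
    by (intro continuous_on_sum continuous_on_scaleR continuous_on_product_coordinates continuous_on_const)
  have contH: "continuous_on UNIV H"
  proof (rule continuous_on_coordinatewise_then_product)
    fix i
    have "continuous_on UNIV (\<lambda>z :: real \<times> (nat \<Rightarrow> real). h i (time (fst z), r (vec (snd z))))"
      by (intro continuous_on_compose2[OF conth] continuous_on_Pair
          continuous_on_compose2[OF cont_time] continuous_on_compose2[OF contr]
          continuous_on_compose2[OF cont_vec] continuous_intros) auto
    then show "continuous_on UNIV (\<lambda>z. H z i)"
      by (cases "i < n") (simp_all add: H_def)
  qed
  have Him: "H z \<in> nat_cube n" for z
    using h01 by (auto simp: H_def nat_cube_def)
  (* Closeness is measured on the vectors, not on their coefficients: this is what is needed below. *)
  define U where "U = {z. dist (vec (snd z)) (vec (H z)) < \<delta> / 2}"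
  have "open U"
    unfolding U_def
    by (intro open_Collect_less continuous_intros continuous_on_compose2[OF cont_vec] contH) auto
  obtain p where p: "path p" "path_image p \<subseteq> U" "fst (pathstart p) = 0" "fst (pathfinish p) = 1"
    using browder_path[OF contH Him \<open>open U\<close>] \<open>0 < \<delta>\<close> by (auto simp: U_def)
  have contp: "continuous_on {0..1} p" using p(1) by (simp add: path_def)
  show ?thesis
  proof
    show "continuous_on {0..1} (\<lambda>s. time (fst (p s)))" "continuous_on {0..1} (\<lambda>s. vec (snd (p s)))"
      by (intro continuous_on_compose2[OF cont_time] continuous_on_compose2[OF cont_vec]
          continuous_intros contp subset_UNIV)+
    fix s
    have "0 \<le> (b - a) * max 0 (min 1 x)" "(b - a) * max 0 (min 1 x) \<le> (b - a) * 1" for x :: real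
      using \<open>a < b\<close> by (intro mult_nonneg_nonneg mult_left_mono; simp)+
    then show "time (fst (p s)) \<in> {a..b}"
      unfolding time_def by (simp add: algebra_simps)
    show "time (fst (p 0)) = a" "time (fst (p 1)) = b"
      using p by (auto simp: pathstart_def pathfinish_def time_def)
    assume s: "s \<in> {0..1}" and W: "(time (fst (p s)), r (vec (snd (p s)))) \<in> W"
    define z where "z = (time (fst (p s)), r (vec (snd (p s))))"
    have "vec (H (p s)) = (\<Sum>i<n. coeff i (g z) *\<^sub>R y i)"
      unfolding vec_def H_def using hW W by (auto simp: z_def vec_def)
    then have "dist (g z) (vec (H (p s))) < \<delta> / 2"
      using coeff(3)[of "g z"] gK W by (auto simp: z_def)
    moreover have "dist (vec (snd (p s))) (vec (H (p s))) < \<delta> / 2"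
    proof -
      have "p s \<in> U" using p(2) s unfolding path_image_def by blast
      then show ?thesis by (simp add: U_def)
    qed
    ultimately show "dist (vec (snd (p s))) (g (time (fst (p s)), r (vec (snd (p s))))) < \<delta>"
      unfolding z_def[symmetric] by metric
  qed
qed

section \<open>The fixed point theorem\<close>

theorem theorem2p1:
  fixes A :: "'a::real_normed_vector set"
    and a b :: real
    and C Cl Cr D W :: "(real \<times> 'a) set"
    and \<phi> :: "real \<times> 'a \<Rightarrow> real \<times> 'a"
  assumes "A retract_of (UNIV :: 'a set)"
    and "a < b"
    and "C = {a..b} \<times> A"
    and "Cl = {a} \<times> A"
    and "Cr = {b} \<times> A"
    and "closed W" and "W \<subseteq> D \<inter> C"
    and "compact_map_on W \<phi>"
    and "\<And>(\<sigma> :: real \<Rightarrow> real \<times> 'a) s t.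
           s \<le> t \<Longrightarrow> continuous_on {s..t} \<sigma> \<Longrightarrow> \<sigma> ` {s..t} \<subseteq> C \<Longrightarrow>
           \<sigma> ` {s..t} \<inter> Cl \<noteq> {} \<Longrightarrow> \<sigma> ` {s..t} \<inter> Cr \<noteq> {} \<Longrightarrow>
           \<exists>s0 s1. s \<le> s0 \<and> s0 \<le> s1 \<and> s1 \<le> t \<and>
             \<sigma> ` {s0..s1} \<subseteq> W \<and>
             \<phi> ` \<sigma> ` {s0..s1} \<subseteq> C \<and>
             \<phi> ` \<sigma> ` {s0..s1} \<inter> Cl \<noteq> {} \<and>
             \<phi> ` \<sigma> ` {s0..s1} \<inter> Cr \<noteq> {}"
  shows "\<exists>z\<in>W. \<phi> z = z"
proof -
  obtain r where contr: "continuous_on UNIV r" and rA: "\<And>x. r x \<in> A" and r_id: "\<And>x. x \<in> A \<Longrightarrow> r x = x"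
    using assms(1) unfolding retract_of_def retraction_def by auto
  have "closed A"
    using assms(1) by (rule retract_of_closed[OF closed_UNIV])
  define K where "K = closure (\<phi> ` W)"
  have "compact K" and cont\<phi>: "continuous_on W \<phi>"
    using assms(8) by (auto simp: compact_map_on_def K_def)
  have \<phi>K: "\<phi> z \<in> K" if "z \<in> W" for z
    using that closure_subset[of "\<phi> ` W"] by (auto simp: K_def)
  have "compact (snd ` K)"
    by (intro compact_continuous_image continuous_intros \<open>compact K\<close>)
  have approx: "\<exists>u z. z \<in> W \<and> snd z = r u \<and> fst (\<phi> z) = fst z \<and> snd (\<phi> z) \<in> A \<and> dist u (snd (\<phi> z)) < \<delta>"
    if \<delta>: "0 < \<delta>" for \<delta>
  proof -
    have cont_snd: "continuous_on W (\<lambda>z. snd (\<phi> z))"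
      by (rule continuous_on_snd[OF cont\<phi>])
    have snd_K: "(\<lambda>z. snd (\<phi> z)) ` W \<subseteq> snd ` K"
      using \<phi>K by auto
    obtain t :: "real \<Rightarrow> real" and u :: "real \<Rightarrow> 'a" where contt: "continuous_on {0..1} t" and contu: "continuous_on {0..1} u"
      and t: "\<And>s. t s \<in> {a..b}" "t 0 = a" "t 1 = b"
      and near: "\<And>s. \<lbrakk>s \<in> {0..1}; (t s, r (u s)) \<in> W\<rbrakk> \<Longrightarrow> dist (u s) (snd (\<phi> (t s, r (u s)))) < \<delta>"
      by (rule approximate_crossing_path[OF contr \<open>closed W\<close> cont_snd \<open>compact (snd ` K)\<close> snd_K \<delta> \<open>a < b\<close>]) blast
    define \<sigma> where "\<sigma> s = (t s, r (u s))" for s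
    have cont\<sigma>: "continuous_on {0..1} \<sigma>"
      unfolding \<sigma>_def
      by (intro continuous_on_Pair contt continuous_on_compose2[OF contr contu]) auto
    have "\<sigma> ` {0..1} \<inter> Cl \<noteq> {}"
      using t rA by (auto simp: \<sigma>_def assms(4) intro!: image_eqI[of _ _ 0] exI[of _ "\<sigma> 0"])
    moreover have "\<sigma> ` {0..1} \<inter> Cr \<noteq> {}"
      using t rA by (auto simp: \<sigma>_def assms(5) intro!: image_eqI[of _ _ 1] exI[of _ "\<sigma> 1"])
    moreover have "\<sigma> ` {0..1} \<subseteq> C"
      using t rA by (auto simp: \<sigma>_def assms(3))
    ultimately obtain s0 s1 where s01: "0 \<le> s0" "s0 \<le> s1" "s1 \<le> 1"
      and \<gamma>W: "\<sigma> ` {s0..s1} \<subseteq> W" and \<gamma>C: "\<phi> ` \<sigma> ` {s0..s1} \<subseteq> C"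
      and \<gamma>l: "\<phi> ` \<sigma> ` {s0..s1} \<inter> Cl \<noteq> {}" and \<gamma>r: "\<phi> ` \<sigma> ` {s0..s1} \<inter> Cr \<noteq> {}"
      using assms(9)[OF zero_le_one cont\<sigma>] by blast
    (* d is at most 0 where the image is on the left face and at least 0 where it is on the right one. *)
    define d where "d s = fst (\<phi> (\<sigma> s)) - t s" for s
    have "continuous_on {s0..s1} d"
      unfolding d_def
      using s01 by (intro continuous_intros continuous_on_compose2[OF cont\<phi> _ \<gamma>W]
          continuous_on_subset[OF cont\<sigma>] continuous_on_subset[OF contt]) auto
    then have "connected (d ` {s0..s1})"
      by (intro connected_continuous_image) auto
    moreover obtain sl where sl: "sl \<in> {s0..s1}" "\<phi> (\<sigma> sl) \<in> Cl" using \<gamma>l by blast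
    moreover have "d sl \<le> 0"
      using sl(2) t(1)[of sl] by (auto simp: d_def assms(4))
    moreover obtain sr where sr: "sr \<in> {s0..s1}" "\<phi> (\<sigma> sr) \<in> Cr" using \<gamma>r by blast
    moreover have "0 \<le> d sr"
      using sr(2) t(1)[of sr] by (auto simp: d_def assms(5))
    ultimately have "0 \<in> d ` {s0..s1}"
      using connectedD_interval[of "d ` {s0..s1}" "d sl" "d sr" 0] by blast
    then obtain s where s: "s \<in> {s0..s1}" "d s = 0" by auto
    then have "\<phi> (\<sigma> s) \<in> C" "\<sigma> s \<in> W" using \<gamma>C \<gamma>W by auto
    then show ?thesis
      using s s01 near[of s] by (intro exI[of _ "u s"] exI[of _ "\<sigma> s"]) (auto simp: d_def \<sigma>_def assms(3))
  qed
  have "\<exists>u z. z \<in> W \<and> snd z = r u \<and> fst (\<phi> z) = fst z \<and> snd (\<phi> z) \<in> A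
           \<and> dist u (snd (\<phi> z)) < 1 / real (Suc k)" for k
    by (rule approx) simp
  then obtain u z where zW: "\<And>k. z k \<in> W" and zr: "\<And>k. snd (z k) = r (u k)"
    and z1: "\<And>k. fst (\<phi> (z k)) = fst (z k)" and zA: "\<And>k. snd (\<phi> (z k)) \<in> A"
    and zu: "\<And>k. dist (u k) (snd (\<phi> (z k))) < 1 / real (Suc k)"
    by metis
  obtain w \<theta> where \<theta>: "strict_mono (\<theta> :: nat \<Rightarrow> nat)" and w: "(\<lambda>k. \<phi> (z (\<theta> k))) \<longlonglongrightarrow> w"
    using \<open>compact K\<close>[unfolded compact_eq_seq_compact_metric seq_compact_def, rule_format,
        of "\<lambda>k. \<phi> (z k)"] zW \<phi>K by (auto simp: o_def)
  have w2: "(\<lambda>k. snd (\<phi> (z (\<theta> k)))) \<longlonglongrightarrow> snd w" by (intro tendsto_intros w)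
  (* The limit of \<phi>\<^sub>2 lies in A and is fixed by r, so the points z have the same limit w as \<phi> z. *)
  have "snd w \<in> A"
    by (rule closed_sequentially[OF \<open>closed A\<close> _ w2]) (simp add: zA)
  have "(\<lambda>k. 1 / real (Suc (\<theta> k))) \<longlonglongrightarrow> 0"
    using LIMSEQ_subseq_LIMSEQ[OF LIMSEQ_Suc[OF lim_1_over_n] \<theta>] by (simp add: o_def)
  then have "(\<lambda>k. u (\<theta> k) - snd (\<phi> (z (\<theta> k)))) \<longlonglongrightarrow> 0"
    by (rule Lim_null_comparison[rotated]) (use zu in \<open>auto simp: dist_norm less_imp_le\<close>)
  then have "(\<lambda>k. u (\<theta> k)) \<longlonglongrightarrow> snd w"
    using tendsto_add[OF _ w2] by fastforce
  then have "(\<lambda>k. r (u (\<theta> k))) \<longlonglongrightarrow> r (snd w)"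
    by (intro continuous_on_tendsto_compose[OF contr]) auto
  then have "(\<lambda>k. (fst (\<phi> (z (\<theta> k))), r (u (\<theta> k)))) \<longlonglongrightarrow> (fst w, snd w)"
    using r_id[OF \<open>snd w \<in> A\<close>] by (intro tendsto_Pair tendsto_fst w) simp
  then have z_lim: "(\<lambda>k. z (\<theta> k)) \<longlonglongrightarrow> w"
    by (simp add: z1 flip: zr)
  have "w \<in> W"
    by (rule closed_sequentially[OF \<open>closed W\<close> _ z_lim]) (simp add: zW)
  then have "(\<lambda>k. \<phi> (z (\<theta> k))) \<longlonglongrightarrow> \<phi> w"
    by (intro continuous_on_tendsto_compose[OF cont\<phi> z_lim]) (use zW in auto)
  then have "\<phi> w = w" using w LIMSEQ_unique by blast
  then show ?thesis using \<open>w \<in> W\<close> by blast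
qed

end
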